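(* Let $n\geqslant 3$. There exists an open set $E\subset\mathbb{R}^n$ that is both weakly $1$-convex and weakly $1$-semiconvex, with $E^{\diamondsuit}\neq\varnothing$ and $E^{\triangle}\neq\varnothing$, such that $E^{\diamondsuit}=E^{\triangle}$ and this set is bounded, connected, and non-convex. Likewise, there exists an open set $E\subset\mathbb{R}^n$ that is both weakly $1$-convex and weakly $1$-semiconvex, with $E^{\diamondsuit}\neq\varnothing$ and $E^{\triangle}\neq\varnothing$, such that $E^{\diamondsuit}=E^{\triangle}$ and this set is unbounded, connected, and non-convex.
   Context: $\mathbb{R}^n$ carries the Euclidean norm. A ray is a closed half-line $\{y+t\alpha: t\in[0,+\infty)\}$ with $y\in\mathbb{R}^n$ and $\|\alpha\|=1$; it emanates from $y$. An open set $E\subset\mathbb{R}^n$ is called weakly $1$-convex (respectively weakly $1$-semiconvex) if for every point $x\in\partial E$ there exists a straight line (respectively a ray) $L$ with $x\in L$ and $L\cap E=\varnothing$. A point $x\in\mathbb{R}^n\setminus E$ is a $1$-nonconvexity point (respectively $1$-nonsemiconvexity point) of $E$ if every straight line passing through $x$ (respectively every ray emanating from $x$) intersects $E$. $E^{\triangle}$ denotes the set of all $1$-nonconvexity points of $E$, and $E^{\diamondsuit}$ the set of all $1$-nonsemiconvexity points of $E$. *)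

theory Defs
  imports "HOL-Analysis.Analysis"
begin

definition straight_line :: "'a::euclidean_space set \<Rightarrow> bool" where
  "straight_line L \<longleftrightarrow> (\<exists>y \<alpha>. norm \<alpha> = 1 \<and> L = {y + t *\<^sub>R \<alpha> | t. t \<in> (UNIV :: real set)})"

definition ray_from :: "'a::euclidean_space \<Rightarrow> 'a set \<Rightarrow> bool" where
  "ray_from y L \<longleftrightarrow> (\<exists>\<alpha>. norm \<alpha> = 1 \<and> L = {y + t *\<^sub>R \<alpha> | t. t \<in> {0::real..}})"

definition is_ray :: "'a::euclidean_space set \<Rightarrow> bool" where
  "is_ray L \<longleftrightarrow> (\<exists>y. ray_from y L)"

definition weakly_1_convex :: "'a::euclidean_space set \<Rightarrow> bool" where
  "weakly_1_convex E \<longleftrightarrow>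
     open E \<and> (\<forall>x\<in>frontier E. \<exists>L. straight_line L \<and> x \<in> L \<and> L \<inter> E = {})"

(* The ray only has to contain x; it need not emanate from x. *)
definition weakly_1_semiconvex :: "'a::euclidean_space set \<Rightarrow> bool" where
  "weakly_1_semiconvex E \<longleftrightarrow>
     open E \<and> (\<forall>x\<in>frontier E. \<exists>L. is_ray L \<and> x \<in> L \<and> L \<inter> E = {})"

definition nonconvexity_points :: "'a::euclidean_space set \<Rightarrow> 'a set" where
  "nonconvexity_points E =
     {x. x \<notin> E \<and> (\<forall>L. straight_line L \<and> x \<in> L \<longrightarrow> L \<inter> E \<noteq> {})}"

definition nonsemiconvexity_points :: "'a::euclidean_space set \<Rightarrow> 'a set" where
  "nonsemiconvexity_points E =
     {x. x \<notin> E \<and> (\<forall>L. ray_from x L \<longrightarrow> L \<inter> E \<noteq> {})}"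

end

theory Submission
  imports Defs "HOL-Real_Asymp.Real_Asymp"
begin

text \<open>
  In terms of the closed complement \<open>C\<close> of \<open>E\<close>, every boundary point of \<open>C\<close> has to lie on a line
  inside \<open>C\<close>, and the nonconvexity points are the points of \<open>C\<close> on no line inside \<open>C\<close>. Fix
  a vertical axis \<open>k\<close>, a closed vertical cylinder \<open>A\<close> all of whose rays are vertical, and an
  open vertical cylinder \<open>V \<subseteq> A\<close>. Let \<open>C\<close> be the union of \<open>A - V\<close>, of the part of
  \<open>A\<close> in the slab \<open>0 \<le> x\<^sub>k \<le> 1\<close>, and of the two hyperplanes bounding the slab. The first part is
  swept out by vertical lines and the hyperplanes by horizontal ones, whereas a ray issuing from
  a point of the open set \<open>{x \<in> V. 0 < x\<^sub>k < 1}\<close> leaves \<open>C\<close>: through the top or bottom if it is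
  vertical, and by leaving \<open>A\<close> otherwise. So this open set is both \<open>E\<^sup>\<triangle>\<close> and \<open>E\<^sup>\<diamond>\<close>. Taking for
  \<open>A\<close> a parabolic shell, which contains bent tubes \<open>V\<close> of bounded as well as of
  unbounded base, gives the two examples.
\<close>

section \<open>Carving a slab out of vertical cylinders\<close>

lemma axis_component: "axis k c $ l = (if l = k then c else 0)"
  by (simp add: axis_def)

text \<open>For \<open>V\<close> inside \<open>A\<close>, this is the complement of the closed set
  \<open>C\<close>, split into its pieces outside and inside \<open>A\<close>; openness can be read
  off from each piece.\<close>

definition slab_carving :: "'n \<Rightarrow> (real ^ 'n) set \<Rightarrow> (real ^ 'n) set \<Rightarrow> (real ^ 'n) set" where
  "slab_carving k A V =
     {x. x \<notin> A \<and> x $ k \<noteq> 0 \<and> x $ k \<noteq> 1} \<union> {x \<in> V. x $ k < 0 \<or> 1 < x $ k}"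

definition slab_part :: "'n \<Rightarrow> (real ^ 'n) set \<Rightarrow> (real ^ 'n) set" where
  "slab_part k V = {x \<in> V. 0 < x $ k \<and> x $ k < 1}"

definition vertical_cylinder :: "'n \<Rightarrow> (real ^ 'n) set \<Rightarrow> bool" where
  "vertical_cylinder k S \<longleftrightarrow> (\<forall>x t. x \<in> S \<longrightarrow> x + t *\<^sub>R axis k 1 \<in> S)"

lemma vertical_cylinder_iff:
  assumes "vertical_cylinder k S"
  shows "x + t *\<^sub>R axis k 1 \<in> S \<longleftrightarrow> x \<in> S"
proof
  assume "x + t *\<^sub>R axis k 1 \<in> S"
  then have "(x + t *\<^sub>R axis k 1) + (- t) *\<^sub>R axis k 1 \<in> S"
    using assms unfolding vertical_cylinder_def by blast
  then show "x \<in> S" by simp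
qed (use assms in \<open>simp add: vertical_cylinder_def\<close>)

lemma open_slab_carving:
  assumes "closed A" "open V"
  shows "open (slab_carving k A V)"
proof -
  have "open (- A \<inter> {x. x $ k \<noteq> 0} \<inter> {x. x $ k \<noteq> 1} \<union> V \<inter> ({x. x $ k < 0} \<union> {x. 1 < x $ k}))"
    using assms by (intro open_Un open_Int open_Compl open_Collect_neq open_Collect_less continuous_intros)
  also have "\<dots> = slab_carving k A V"
    by (auto simp: slab_carving_def)
  finally show ?thesis .
qed

lemma open_slab_part:
  assumes "open V"
  shows "open (slab_part k V)"
proof -
  have "open (V \<inter> {x. 0 < x $ k} \<inter> {x. x $ k < 1})"
    using assms by (intro open_Int open_Collect_less continuous_intros)
  also have "\<dots> = slab_part k V"
    by (auto simp: slab_part_def)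
  finally show ?thesis .
qed

lemma disjoint_slab_part_carving:
  assumes "V \<subseteq> A"
  shows "slab_part k V \<inter> slab_carving k A V = {}"
  using assms by (auto simp: slab_part_def slab_carving_def)

lemma line_avoiding_slab_carving:
  fixes x :: "real ^ 'n"
  assumes "j \<noteq> k" "vertical_cylinder k A" "vertical_cylinder k V"
    and "x \<notin> slab_carving k A V" "x \<notin> slab_part k V"
  shows "\<exists>L. straight_line L \<and> x \<in> L \<and> L \<inter> slab_carving k A V = {}"
proof -
  have *: ?thesis if "\<And>t. x + t *\<^sub>R axis l 1 \<notin> slab_carving k A V" for l
  proof (intro exI conjI)
    let ?L = "{x + t *\<^sub>R axis l 1 |t. t \<in> (UNIV :: real set)}"
    show "straight_line ?L"
      unfolding straight_line_def by (rule exI[of _ x], rule exI[of _ "axis l 1"]) simp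
    show "x \<in> ?L" by (auto intro: exI[of _ 0])
    show "?L \<inter> slab_carving k A V = {}" using that by auto
  qed
  show ?thesis
  \<comment> \<open>The direction \<open>j\<close> keeps a line inside a bounding hyperplane, which
    misses the carving altogether.\<close>
  proof (cases "x $ k = 0 \<or> x $ k = 1")
    case True
    then show ?thesis
      using assms(1) by (intro *[of j]) (auto simp: slab_carving_def axis_component)
  next
    case False
    \<comment> \<open>The height of a point of \<open>V\<close> off the two hyperplanes puts it in
      the carving or in the slab part, and both are excluded.\<close>
    then have "x \<in> A" "x \<notin> V"
      using assms(4,5) by (auto simp: slab_carving_def slab_part_def)
    then show ?thesis
      by (intro *[of k]) (auto simp: slab_carving_def vertical_cylinder_iff assms(2,3))
  qed
qed

text \<open>A ray that has left \<open>A\<close> must also avoid the two hyperplanes. An affine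
  function attains a value at most once unless it is constant, and its value at 0 rules out the
  constant \<open>c\<close>.\<close>

lemma eventually_affine_neq:
  fixes a b c :: real
  assumes "a \<noteq> c"
  shows "eventually (\<lambda>t. a + t * b \<noteq> c) at_top"
proof (cases "b = 0")
  case False
  have "eventually (\<lambda>t. t \<noteq> (c - a) / b) at_top"
    using eventually_gt_at_top[of "(c - a) / b"] by eventually_elim simp
  then show ?thesis
    by eventually_elim (use False in \<open>auto simp: nonzero_eq_divide_eq eq_diff_eq add.commute\<close>)
qed (use assms in simp)

lemma ray_meets_slab_carving:
  fixes x :: "real ^ 'n"
  assumes cyl: "vertical_cylinder k V"
    and leave: "\<And>y \<alpha> l. l \<noteq> k \<Longrightarrow> \<alpha> $ l \<noteq> 0 \<Longrightarrow> eventually (\<lambda>t. y + t *\<^sub>R \<alpha> \<notin> A) at_top"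
    and x: "x \<in> slab_part k V" and L: "ray_from x L"
  shows "L \<inter> slab_carving k A V \<noteq> {}"
proof -
  obtain \<alpha> where \<alpha>: "norm \<alpha> = 1" "L = {x + t *\<^sub>R \<alpha> | t. t \<in> {0::real..}}"
    using L unfolding ray_from_def by blast
  have xk: "x \<in> V" "0 < x $ k" "x $ k < 1"
    using x by (auto simp: slab_part_def)
  have "\<exists>t\<ge>0. x + t *\<^sub>R \<alpha> \<in> slab_carving k A V"
  proof (cases "\<exists>l. l \<noteq> k \<and> \<alpha> $ l \<noteq> 0")
    case True
    have "eventually (\<lambda>t. x + t *\<^sub>R \<alpha> \<notin> A) at_top"
      using True leave by blast
    moreover have "eventually (\<lambda>t. x $ k + t * \<alpha> $ k \<noteq> 0) at_top"
      using xk by (intro eventually_affine_neq) auto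
    moreover have "eventually (\<lambda>t. x $ k + t * \<alpha> $ k \<noteq> 1) at_top"
      using xk by (intro eventually_affine_neq) auto
    moreover have "eventually (\<lambda>t::real. 0 \<le> t) at_top"
      by (rule eventually_ge_at_top)
    ultimately have "eventually (\<lambda>t. 0 \<le> t \<and> x + t *\<^sub>R \<alpha> \<in> slab_carving k A V) at_top"
      by eventually_elim (simp add: slab_carving_def)
    then show ?thesis
      using eventually_happens'[OF trivial_limit_at_top_linorder] by blast
  next
    case False
    then have eq: "\<alpha> = (\<alpha> $ k) *\<^sub>R axis k 1"
      by (auto simp: vec_eq_iff axis_component)
    have "norm \<alpha> = \<bar>\<alpha> $ k\<bar>"
      by (subst eq) simp
    then have "\<alpha> $ k = 1 \<or> \<alpha> $ k = -1"
      using \<alpha>(1) by linarith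
    \<comment> \<open>The slab has height 1, so a vertical move of length 2 overshoots it in either
      direction, while staying in \<open>V\<close>.\<close>
    moreover have "x + 2 *\<^sub>R \<alpha> \<in> V"
      using vertical_cylinder_iff[OF cyl, of x "2 * \<alpha> $ k"] xk(1) eq by (metis scaleR_scaleR)
    ultimately have "x + 2 *\<^sub>R \<alpha> \<in> slab_carving k A V"
      using xk by (auto simp: slab_carving_def)
    then show ?thesis
      by (intro exI[of _ 2]) simp
  qed
  then show ?thesis
    using \<alpha>(2) by auto
qed

section \<open>From rays to lines, and the properties of the carved set\<close>

lemma nonsemiconvexity_subset_nonconvexity:
  "nonsemiconvexity_points E \<subseteq> nonconvexity_points E"
proof
  fix x assume x: "x \<in> nonsemiconvexity_points E"
  have "L \<inter> E \<noteq> {}" if L: "straight_line L" "x \<in> L" for L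
  proof -
    obtain y \<alpha> where \<alpha>: "norm \<alpha> = 1" "L = {y + t *\<^sub>R \<alpha> | t. t \<in> (UNIV :: real set)}"
      using L(1) unfolding straight_line_def by blast
    obtain s where s: "x = y + s *\<^sub>R \<alpha>"
      using L(2) \<alpha>(2) by auto
    \<comment> \<open>The line contains the ray from \<open>x\<close> in its own direction, and that
      ray already meets \<open>E\<close>.\<close>
    have "{x + t *\<^sub>R \<alpha> | t. t \<in> {0::real..}} \<inter> E \<noteq> {}"
      using x \<alpha>(1) unfolding nonsemiconvexity_points_def ray_from_def by blast
    then obtain t where "x + t *\<^sub>R \<alpha> \<in> E" by auto
    moreover have "x + t *\<^sub>R \<alpha> = y + (s + t) *\<^sub>R \<alpha>"
      by (simp add: s algebra_simps)
    ultimately show ?thesis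
      unfolding \<alpha>(2) by auto
  qed
  then show "x \<in> nonconvexity_points E"
    using x by (simp add: nonconvexity_points_def nonsemiconvexity_points_def)
qed

text \<open>Half of the avoiding line, cut off at the boundary point, serves as the ray.\<close>

lemma weakly_1_convex_imp_semiconvex:
  assumes "weakly_1_convex E"
  shows "weakly_1_semiconvex E"
  unfolding weakly_1_semiconvex_def
proof (intro conjI ballI)
  show "open E" using assms by (simp add: weakly_1_convex_def)
  fix x assume "x \<in> frontier E"
  then obtain L where L: "straight_line L" "x \<in> L" "L \<inter> E = {}"
    using assms unfolding weakly_1_convex_def by blast
  obtain y \<alpha> where \<alpha>: "norm \<alpha> = 1" "L = {y + t *\<^sub>R \<alpha> | t. t \<in> (UNIV :: real set)}"
    using L(1) unfolding straight_line_def by blast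
  obtain s where s: "x = y + s *\<^sub>R \<alpha>"
    using L(2) \<alpha>(2) by auto
  let ?R = "{x + t *\<^sub>R \<alpha> | t. t \<in> {0::real..}}"
  have "?R \<subseteq> L"
  proof
    fix z assume "z \<in> ?R"
    then obtain t where "z = y + (s + t) *\<^sub>R \<alpha>"
      by (auto simp: s algebra_simps)
    then show "z \<in> L" unfolding \<alpha>(2) by blast
  qed
  moreover have "is_ray ?R"
    using \<alpha>(1) unfolding is_ray_def ray_from_def by blast
  moreover have "x \<in> ?R"
    by (auto intro: exI[of _ 0])
  ultimately show "\<exists>L. is_ray L \<and> x \<in> L \<and> L \<inter> E = {}"
    using L(3) by blast
qed

text \<open>Reduces the theorem to a choice of \<open>A\<close> and \<open>V\<close>: the geometry
  of the nonconvexity set becomes that of \<open>slab_part k V\<close>.\<close>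

lemma slab_carving_properties:
  fixes A V :: "(real ^ 'n) set"
  assumes "j \<noteq> k" "closed A" "open V" "V \<subseteq> A"
    and cyl: "vertical_cylinder k A" "vertical_cylinder k V"
    and leave: "\<And>y \<alpha> l. l \<noteq> k \<Longrightarrow> \<alpha> $ l \<noteq> 0 \<Longrightarrow> eventually (\<lambda>t. y + t *\<^sub>R \<alpha> \<notin> A) at_top"
  defines "E \<equiv> slab_carving k A V"
  shows "weakly_1_convex E"
    and "nonconvexity_points E = slab_part k V"
    and "nonsemiconvexity_points E = slab_part k V"
proof -
  have disj: "slab_part k V \<inter> E = {}"
    unfolding E_def by (rule disjoint_slab_part_carving) fact
  have line: "\<exists>L. straight_line L \<and> x \<in> L \<and> L \<inter> E = {}" if "x \<notin> E" "x \<notin> slab_part k V" for x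
    using line_avoiding_slab_carving[OF assms(1) cyl] that unfolding E_def by blast
  have "open E"
    unfolding E_def by (rule open_slab_carving) fact+
  \<comment> \<open>An open set disjoint from \<open>E\<close> is also disjoint from its closure, so
    no frontier point lies in the slab part.\<close>
  moreover have "x \<notin> E \<and> x \<notin> slab_part k V" if "x \<in> frontier E" for x
    using that disj \<open>open E\<close> open_Int_closure_eq_empty[OF open_slab_part[OF \<open>open V\<close>]]
    by (auto simp: frontier_def interior_open)
  ultimately show "weakly_1_convex E"
    using line unfolding weakly_1_convex_def by blast
  have sub: "nonconvexity_points E \<subseteq> slab_part k V"
    using line unfolding nonconvexity_points_def by blast
  have "L \<inter> E \<noteq> {}" if "x \<in> slab_part k V" "ray_from x L" for x L
    unfolding E_def using cyl(2) leave that by (rule ray_meets_slab_carving)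
  then have sup: "slab_part k V \<subseteq> nonsemiconvexity_points E"
    using disj unfolding nonsemiconvexity_points_def by blast
  \<comment> \<open>The three inclusions close a cycle, so all three sets coincide.\<close>
  show "nonconvexity_points E = slab_part k V" "nonsemiconvexity_points E = slab_part k V"
    using sub sup nonsemiconvexity_subset_nonconvexity[of E] by blast+
qed

section \<open>The parabolic shell and its tubes\<close>

definition square_sum :: "'n::finite \<Rightarrow> 'n \<Rightarrow> real ^ 'n \<Rightarrow> real" where
  "square_sum j k x = (\<Sum>l\<in>- {j, k}. (x $ l)\<^sup>2)"

text \<open>For distinct \<open>j\<close> and \<open>k\<close>, \<open>square_sum\<close> is the
  squared distance to the plane of these two axes. The shell is thus the region between a paraboloid
  and its unit translate along axis \<open>j\<close>, times the \<open>k\<close> axis.\<close>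

definition parabolic_shell :: "'n::finite \<Rightarrow> 'n \<Rightarrow> (real ^ 'n) set" where
  "parabolic_shell j k = {x. x $ j - square_sum j k x \<in> {0..1}}"

text \<open>The parameter \<open>J\<close> serves both examples: it decides whether the base is
  bounded.\<close>

definition parabolic_tube :: "real set \<Rightarrow> 'n::finite \<Rightarrow> 'n \<Rightarrow> (real ^ 'n) set" where
  "parabolic_tube J j k =
     {x. x $ j - square_sum j k x \<in> {0<..<1} \<and> (\<forall>l\<in>- {j, k}. x $ l \<in> J)}"

lemma continuous_on_square_sum [continuous_intros]:
  "continuous_on S (square_sum j k)"
  unfolding square_sum_def by (intro continuous_intros)

lemma square_sum_vertical [simp]:
  "square_sum j k (x + t *\<^sub>R axis k 1) = square_sum j k x"
  unfolding square_sum_def by (intro sum.cong) (auto simp: axis_component)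

lemma square_sum_shear [simp]:
  "square_sum j k (x + t *\<^sub>R axis j 1) = square_sum j k x"
  unfolding square_sum_def by (intro sum.cong) (auto simp: axis_component)

lemma closed_parabolic_shell: "closed (parabolic_shell j k)"
proof -
  have "closed ((\<lambda>x. x $ j - square_sum j k x) -` {0..1})"
    by (rule closed_vimage) (auto intro!: continuous_intros)
  then show ?thesis by (simp add: parabolic_shell_def vimage_def)
qed

lemma open_parabolic_tube:
  assumes "open J"
  shows "open (parabolic_tube J j k)"
proof -
  have "open ((\<lambda>x. x $ j - square_sum j k x) -` {0<..<1} \<inter> (\<Inter>l\<in>- {j, k}. (\<lambda>x. x $ l) -` J))"
    using assms by (intro open_Int open_INT open_vimage ballI continuous_intros) simp_all
  also have "\<dots> = parabolic_tube J j k"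
    by (auto simp: parabolic_tube_def)
  finally show ?thesis .
qed

lemma parabolic_tube_subset_shell: "parabolic_tube J j k \<subseteq> parabolic_shell j k"
  by (auto simp: parabolic_tube_def parabolic_shell_def)

lemma vertical_cylinder_parabolic:
  assumes "j \<noteq> k"
  shows "vertical_cylinder k (parabolic_shell j k)" "vertical_cylinder k (parabolic_tube J j k)"
  using assms by (auto simp: vertical_cylinder_def parabolic_shell_def parabolic_tube_def axis_component)

text \<open>Along a ray the defining function of the shell is a quadratic polynomial in
  \<open>t\<close> with leading coefficient \<open>- c\<close>, where \<open>c\<close> is
  nonnegative. It is not constant, so it escapes the unit interval.\<close>

lemma eventually_leaves_parabolic_shell:
  fixes y :: "real ^ 'n"
  assumes "l \<noteq> k" "\<alpha> $ l \<noteq> 0"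
  shows "eventually (\<lambda>t. y + t *\<^sub>R \<alpha> \<notin> parabolic_shell j k) at_top"
proof -
  define a where "a = y $ j - square_sum j k y"
  define b where "b = \<alpha> $ j - 2 * (\<Sum>l\<in>- {j, k}. y $ l * \<alpha> $ l)"
  define c where "c = square_sum j k \<alpha>"
  have q: "(y + t *\<^sub>R \<alpha>) $ j - square_sum j k (y + t *\<^sub>R \<alpha>) = a + b * t - c * t\<^sup>2" for t
    unfolding a_def b_def c_def square_sum_def
    by (simp add: power2_sum sum.distrib sum_distrib_left sum_distrib_right power_mult_distrib algebra_simps)
  have c0: "c \<ge> 0"
    unfolding c_def square_sum_def by (intro sum_nonneg) simp
  have "eventually (\<lambda>t. a + b * t - c * t\<^sup>2 < 0) at_top \<or> eventually (\<lambda>t. a + b * t - c * t\<^sup>2 > 1) at_top"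
  proof (cases "c = 0")
    case False
    with c0 have "c > 0" by simp
    then have "filterlim (\<lambda>t. a + b * t - c * t\<^sup>2) at_bot at_top"
      by real_asymp
    then show ?thesis unfolding filterlim_at_bot_dense by blast
  next
    \<comment> \<open>Here the direction has only \<open>j\<close> and \<open>k\<close> components.
      The nonvertical one must be \<open>j\<close>, which leaves a linear function of nonzero
      slope.\<close>
    case True
    then have z: "\<alpha> $ m = 0" if "m \<in> - {j, k}" for m
      using that unfolding c_def square_sum_def by (subst (asm) sum_nonneg_eq_0_iff) auto
    then have "b = \<alpha> $ j" by (simp add: b_def)
    moreover have "l = j" using z[of l] assms by auto
    ultimately have "b \<noteq> 0" using assms(2) by simp
    then consider "b > 0" | "b < 0" by linarith
    then show ?thesis
    proof cases
      case 1
      then have "filterlim (\<lambda>t. a + b * t) at_top at_top" by real_asymp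
      then show ?thesis using True by (auto simp: filterlim_at_top_dense)
    next
      case 2
      then have "filterlim (\<lambda>t. a + b * t) at_bot at_top" by real_asymp
      then show ?thesis using True by (auto simp: filterlim_at_bot_dense)
    qed
  qed
  then show ?thesis
    unfolding parabolic_shell_def mem_Collect_eq q by (auto elim: eventually_mono)
qed

section \<open>Shape of the slab part: connected, nonconvex, bounded or not\<close>

lemma slab_part_parabolic_tube:
  assumes "j \<noteq> k"
  shows "slab_part k (parabolic_tube J j k) =
    (\<lambda>p. p + square_sum j k p *\<^sub>R axis j 1) `
      {p. \<forall>l. p $ l \<in> (if l = j \<or> l = k then {0<..<1} else J)}" (is "_ = ?\<Phi> ` ?B")
proof
  show "?\<Phi> ` ?B \<subseteq> slab_part k (parabolic_tube J j k)"
  proof (rule image_subsetI)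
    fix p assume p: "p \<in> ?B"
    then have "p $ j \<in> {0<..<1}" "p $ k \<in> {0<..<1}" "\<forall>l\<in>- {j, k}. p $ l \<in> J"
      by (auto split: if_splits)
    then show "?\<Phi> p \<in> slab_part k (parabolic_tube J j k)"
      using assms by (auto simp: slab_part_def parabolic_tube_def axis_component)
  qed
  show "slab_part k (parabolic_tube J j k) \<subseteq> ?\<Phi> ` ?B"
  proof
    fix x assume x: "x \<in> slab_part k (parabolic_tube J j k)"
    \<comment> \<open>The tube is a box sheared along axis \<open>j\<close>. Since
      \<open>square_sum\<close> ignores that coordinate, the opposite shear is the inverse.\<close>
    let ?p = "x + (- square_sum j k x) *\<^sub>R axis j 1"
    have "x = ?\<Phi> ?p"
      by (simp only: square_sum_shear) simp
    moreover have "?p \<in> ?B"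
      using x assms by (auto simp: slab_part_def parabolic_tube_def axis_component)
    ultimately show "x \<in> ?\<Phi> ` ?B" by blast
  qed
qed

lemma connected_slab_part_parabolic_tube:
  assumes "j \<noteq> k" "convex J"
  shows "connected (slab_part k (parabolic_tube J j k))"
proof -
  have "convex {p :: real ^ 'a. \<forall>l. p $ l \<in> (if l = j \<or> l = k then {0<..<1} else J)}"
    using assms(2) by (intro convex_box_cart) auto
  then show ?thesis
    unfolding slab_part_parabolic_tube[OF assms(1)]
    by (intro connected_continuous_image convex_connected continuous_intros)
qed

lemma bounded_slab_part_parabolic_tube:
  assumes "j \<noteq> k" "bounded J"
  shows "bounded (slab_part k (parabolic_tube J j k))"
proof -
  obtain r where r: "\<And>s. s \<in> J \<Longrightarrow> \<bar>s\<bar> \<le> r"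
    using assms(2) unfolding bounded_iff by auto
  \<comment> \<open>The bound 1 covers coordinates \<open>j\<close> and \<open>k\<close>, the bound
    \<open>r\<close> all others. A compact box is used because its image under the nonlinear shear
    is again compact.\<close>
  let ?K = "cbox (\<chi> _. - max 1 r) (\<chi> _. max 1 r) :: (real ^ 'a) set"
  have "{p. \<forall>l. p $ l \<in> (if l = j \<or> l = k then {0<..<1} else J)} \<subseteq> ?K"
  proof
    fix p assume p: "p \<in> {p. \<forall>l. p $ l \<in> (if l = j \<or> l = k then {0<..<1} else J)}"
    have "\<bar>p $ l\<bar> \<le> max 1 r" for l
      using p r[of "p $ l"] by (cases "l = j \<or> l = k") (auto simp: le_max_iff_disj dest: spec[of _ l])
    then show "p \<in> ?K" by (auto simp: mem_box_cart abs_le_iff minus_le_iff)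
  qed
  moreover have "compact ((\<lambda>p. p + square_sum j k p *\<^sub>R axis j 1) ` ?K)"
    by (intro compact_continuous_image continuous_intros compact_cbox)
  ultimately show ?thesis
    unfolding slab_part_parabolic_tube[OF assms(1)]
    by (meson bounded_subset compact_imp_bounded image_mono)
qed

text \<open>A parabola running midway between the walls of the tube, at half the height of the
  slab.\<close>

definition tube_point :: "'n::finite \<Rightarrow> 'n \<Rightarrow> 'n \<Rightarrow> real \<Rightarrow> real ^ 'n" where
  "tube_point i j k s = s *\<^sub>R axis i 1 + (1/2 + s\<^sup>2) *\<^sub>R axis j 1 + (1/2) *\<^sub>R axis k 1"

lemma square_sum_planar:
  assumes "i \<noteq> j" "i \<noteq> k"
  shows "square_sum j k (s *\<^sub>R axis i 1 + u *\<^sub>R axis j 1 + v *\<^sub>R axis k 1) = s\<^sup>2"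
proof -
  have "square_sum j k (s *\<^sub>R axis i 1 + u *\<^sub>R axis j 1 + v *\<^sub>R axis k 1)
      = (\<Sum>l\<in>- {j, k}. if l = i then s\<^sup>2 else 0)"
    unfolding square_sum_def by (intro sum.cong) (auto simp: axis_component)
  also have "\<dots> = s\<^sup>2"
    using assms by (subst sum.delta) auto
  finally show ?thesis .
qed

lemma tube_point_in_slab_part:
  assumes "i \<noteq> j" "i \<noteq> k" "j \<noteq> k" "s \<in> J" "0 \<in> J"
  shows "tube_point i j k s \<in> slab_part k (parabolic_tube J j k)"
proof -
  have "square_sum j k (tube_point i j k s) = s\<^sup>2"
    unfolding tube_point_def using assms(1,2) by (rule square_sum_planar)
  moreover have "tube_point i j k s $ j = 1/2 + s\<^sup>2" "tube_point i j k s $ k = 1/2"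
    using assms(1-3) by (simp_all add: tube_point_def axis_component)
  moreover have "tube_point i j k s $ l \<in> J" if "l \<noteq> j" "l \<noteq> k" for l
    using assms(4,5) that by (simp add: tube_point_def axis_component)
  ultimately show ?thesis
    by (simp add: slab_part_def parabolic_tube_def)
qed

text \<open>The midpoint of a chord of the parabola leaves the tube: for the parameters -1 and 1,
  coordinate \<open>j\<close> is 3/2 while \<open>square_sum\<close> drops to 0, so their difference
  exceeds 1.\<close>

lemma not_convex_slab_part_parabolic_tube:
  assumes "i \<noteq> j" "i \<noteq> k" "j \<noteq> k" "- 1 \<in> J" "0 \<in> J" "1 \<in> J"
  shows "\<not> convex (slab_part k (parabolic_tube J j k))" (is "\<not> convex ?U")
proof
  assume "convex ?U"
  then have "(1/2) *\<^sub>R tube_point i j k (- 1) + (1/2) *\<^sub>R tube_point i j k 1 \<in> ?U"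
    using assms by (intro convexD tube_point_in_slab_part) auto
  also have "(1/2) *\<^sub>R tube_point i j k (- 1) + (1/2) *\<^sub>R tube_point i j k 1
      = 0 *\<^sub>R axis i 1 + (3/2) *\<^sub>R axis j 1 + (1/2) *\<^sub>R axis k 1"
    using assms by (auto simp: tube_point_def vec_eq_iff axis_component)
  finally show False
    using assms(3) square_sum_planar[OF assms(1,2), of 0 "3/2" "1/2"]
    by (auto simp: slab_part_def parabolic_tube_def axis_component)
qed

lemma unbounded_slab_part_parabolic_tube:
  assumes "i \<noteq> j" "i \<noteq> k" "j \<noteq> k"
  shows "\<not> bounded (slab_part k (parabolic_tube UNIV j k))" (is "\<not> bounded ?U")
proof
  assume "bounded ?U"
  then obtain r where r: "\<And>x. x \<in> ?U \<Longrightarrow> norm x \<le> r"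
    unfolding bounded_iff by blast
  \<comment> \<open>Coordinate \<open>i\<close> of a tube point is its parameter, so the parameter
    \<open>r + 1\<close> breaks the bound.\<close>
  have "norm (tube_point i j k (r + 1)) \<le> r"
    using assms by (intro r tube_point_in_slab_part) auto
  moreover have "\<bar>tube_point i j k (r + 1) $ i\<bar> \<le> norm (tube_point i j k (r + 1))"
    by (rule component_le_norm_cart)
  moreover have "tube_point i j k (r + 1) $ i = r + 1"
    using assms by (simp add: tube_point_def axis_component)
  ultimately show False by linarith
qed

theorem theorem5:
  assumes "CARD('n::finite) \<ge> 3"
  shows "(\<exists>E :: (real ^ 'n) set. open E \<and> weakly_1_convex E \<and> weakly_1_semiconvex E
            \<and> nonsemiconvexity_points E \<noteq> {} \<and> nonconvexity_points E \<noteq> {}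
            \<and> nonsemiconvexity_points E = nonconvexity_points E
            \<and> bounded (nonconvexity_points E) \<and> connected (nonconvexity_points E)
            \<and> \<not> convex (nonconvexity_points E))
       \<and> (\<exists>E :: (real ^ 'n) set. open E \<and> weakly_1_convex E \<and> weakly_1_semiconvex E
            \<and> nonsemiconvexity_points E \<noteq> {} \<and> nonconvexity_points E \<noteq> {}
            \<and> nonsemiconvexity_points E = nonconvexity_points E
            \<and> \<not> bounded (nonconvexity_points E) \<and> connected (nonconvexity_points E)
            \<and> \<not> convex (nonconvexity_points E))"
proof -
  \<comment> \<open>Three axes are needed: \<open>k\<close> is vertical, and the tube bends in the
    plane of \<open>i\<close> and \<open>j\<close>.\<close>
  obtain T :: "'n set" where "card T = 3"
    using assms by (meson obtain_subset_with_card_n)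
  then obtain i j k :: 'n where ijk: "i \<noteq> j" "i \<noteq> k" "j \<noteq> k"
    unfolding card_3_iff by blast
  let ?E = "\<lambda>J. slab_carving k (parabolic_shell j k) (parabolic_tube J j k)"
  let ?U = "\<lambda>J. slab_part k (parabolic_tube J j k)"
  have E: "open (?E J)" "weakly_1_convex (?E J)" "weakly_1_semiconvex (?E J)"
    "nonconvexity_points (?E J) = ?U J" "nonsemiconvexity_points (?E J) = ?U J" if "open J" for J
  proof -
    note props = slab_carving_properties[OF ijk(3) closed_parabolic_shell
        open_parabolic_tube[OF that] parabolic_tube_subset_shell
        vertical_cylinder_parabolic[OF ijk(3)] eventually_leaves_parabolic_shell]
    show "weakly_1_convex (?E J)" by (rule props(1))
    then show "open (?E J)" "weakly_1_semiconvex (?E J)"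
      by (simp_all add: weakly_1_convex_def weakly_1_convex_imp_semiconvex)
    show "nonconvexity_points (?E J) = ?U J" "nonsemiconvexity_points (?E J) = ?U J"
      by (rule props(2), assumption+) (rule props(3), assumption+)
  qed
  have U: "connected (?U J)" "\<not> convex (?U J)" "?U J \<noteq> {}"
    if "convex J" "- 1 \<in> J" "0 \<in> J" "1 \<in> J" for J
    using connected_slab_part_parabolic_tube[OF ijk(3) that(1)]
      not_convex_slab_part_parabolic_tube[OF ijk that(2-4)] tube_point_in_slab_part[OF ijk that(3,3)]
    by auto
  \<comment> \<open>This interval is open, convex and bounded, and contains the parameters -1, 0 and
    1 of the nonconvexity argument.\<close>
  have "bounded (?U {-2<..<2})"
    by (rule bounded_slab_part_parabolic_tube[OF ijk(3)]) simp
  moreover have "\<not> bounded (?U UNIV)"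
    by (rule unbounded_slab_part_parabolic_tube[OF ijk])
  ultimately show ?thesis
    using U[of "{-2<..<2}"] U[of UNIV]
    by (intro conjI exI[of _ "?E {-2<..<2}"] exI[of _ "?E UNIV"]) (simp_all add: E)
qed

end
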